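(* Let $n,k$ be integers with $1\le k\le \frac n2$ and let $\xi_1,\dots,\xi_n$ be i.i.d. copies of a real random variable $\xi$. Let $F(t)=\mathbb P(|\xi|>t)$ for $t\ge 0$, and assume that $F$ is strictly decreasing on $[0,\infty)$ with $F(0)=1$, and that $N(t)=\ln\frac1{F(t)}$, $t\ge 0$, is convex (so that $N$ is an Orlicz function). For $j=1,\dots,k$ put $N_j=\frac{2e}{k-j+1}N$. Then for all $0<x_1\le x_2\le\dots\le x_n$ $$c_1\max_{1\le j\le k}\big\|(1/x_i)_{i=j}^n\big\|_{N_j}^{-1}\le \mathbb E\ k\text{-}\min_{1\le i\le n}|x_i\xi_i|\le 16e^2\,C_N\,\ln(k+1)\max_{1\le j\le k}\big\|(1/x_i)_{i=j}^n\big\|_{N_j}^{-1},$$ where $c_1=1-\frac1{\sqrt{2\pi}}$ and $C_N=\max\{N(1),1/N(1)\}$. Moreover, the lower estimate holds without the assumption that $N$ is an Orlicz function (i.e. without convexity of $N$).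
   Context: For real numbers $a_1,\dots,a_n$, $k\text{-}\min_{1\le i\le n}a_i$ denotes the $k$-th smallest of them (counted with multiplicity). An Orlicz function is a left continuous convex function $M:[0,\infty)\to[0,\infty]$ with $M(0)=0$ that is neither identically $0$ nor the function equal to $0$ at $0$ and $\infty$ elsewhere. For an Orlicz function $M$ (or, more generally, a nonnegative increasing function $M$, in which case the expression need not be a norm but the same notation is used) and a finite vector $x=(x_i)_i$, put $$\|x\|_M=\inf\Big\{\rho>0:\ \sum_i M(|x_i|/\rho)\le 1\Big\}.$$ *)

theory Defs
  imports "HOL-Probability.Probability"
begin

text \<open>The \<open>k\<close>-th smallest of \<open>a 1, \<dots>, a n\<close>, meaningful for \<open>1 \<le> k \<le> n\<close>.\<close>

definition k_min :: "nat \<Rightarrow> nat \<Rightarrow> (nat \<Rightarrow> real) \<Rightarrow> real" where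
  "k_min k n a = sort (map a [1..<Suc n]) ! (k - 1)"

text \<open>Functions \<open>[0,\<infinity>) \<rightarrow> [0,\<infinity>]\<close> are represented by functions on all reals; their values at
  negative arguments are irrelevant below.\<close>

definition orlicz_function :: "(real \<Rightarrow> ennreal) \<Rightarrow> bool" where
  "orlicz_function M \<longleftrightarrow>
     M 0 = 0 \<and>
     (\<forall>s\<ge>0. \<forall>t\<ge>0. \<forall>u\<in>{0..1}.
        M ((1 - u) * s + u * t) \<le> ennreal (1 - u) * M s + ennreal u * M t) \<and>
     (\<forall>t>0. continuous (at_left t) M) \<and>
     (\<exists>t>0. M t \<noteq> 0) \<and>
     (\<exists>t>0. M t \<noteq> \<infinity>)"

text \<open>The infimum is taken in \<open>[0,\<infinity>]\<close>, so that it is \<open>\<infinity>\<close> if no \<open>\<rho>\<close> is admissible.\<close>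

definition orlicz_norm :: "(real \<Rightarrow> ennreal) \<Rightarrow> nat set \<Rightarrow> (nat \<Rightarrow> real) \<Rightarrow> ennreal" where
  "orlicz_norm M I x =
     (INF \<rho>\<in>{\<rho>::real. \<rho> > 0 \<and> (\<Sum>i\<in>I. M (\<bar>x i\<bar> / \<rho>)) \<le> 1}. ennreal \<rho>)"

text \<open>For a finite function vanishing only at \<open>0\<close>, being an Orlicz function amounts to convexity.\<close>

lemma orlicz_function_ennreal_iff:
  fixes N :: "real \<Rightarrow> real"
  assumes N0: "N 0 = 0" and pos: "\<And>t. t > 0 \<Longrightarrow> N t > 0"
  shows "orlicz_function (\<lambda>t. ennreal (N t)) \<longleftrightarrow> convex_on {0..} N"
proof -
  have nn: "N t \<ge> 0" if "t \<ge> 0" for t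
    using that N0 pos[of t] by (cases "t = 0") auto
  have conv: "ennreal (N ((1 - u) * s + u * t)) \<le> ennreal (1 - u) * ennreal (N s) + ennreal u * ennreal (N t)
      \<longleftrightarrow> N ((1 - u) * s + u * t) \<le> (1 - u) * N s + u * N t"
    if "s \<ge> 0" "t \<ge> 0" "u \<in> {0..1}" for s t u
    using that nn[of s] nn[of t] by (simp flip: ennreal_mult ennreal_plus add: ennreal_le_iff)
  show ?thesis
  proof
    assume "orlicz_function (\<lambda>t. ennreal (N t))"
    then show "convex_on {0..} N"
      unfolding orlicz_function_def by (intro convex_onI) (auto simp: conv)
  next
    assume c: "convex_on {0..} N"
    have "convex_on {0<..} N"
      using c by (rule convex_on_subset) auto
    then have "continuous_on {0<..} N"
      by (intro convex_on_continuous) auto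
    then have ct: "isCont N t" if "t > 0" for t
      using that by (simp add: continuous_on_eq_continuous_at)
    have "continuous (at_left t) (\<lambda>t. ennreal (N t))" if "t > 0" for t
      using continuous_at_imp_continuous_at_within[OF ct[OF that]]
      by (simp add: continuous_within tendsto_ennrealI)
    moreover have "N ((1 - u) * s + u * t) \<le> (1 - u) * N s + u * N t"
      if "s \<ge> 0" "t \<ge> 0" "u \<in> {0..1}" for s t u
      using convex_onD[OF c, of u s t] that by simp
    ultimately show "orlicz_function (\<lambda>t. ennreal (N t))"
      unfolding orlicz_function_def using N0 pos[of 1]
      by (auto simp: conv intro!: exI[of _ 1])
  qed
qed

end

theory Submission
  imports Defs
begin

text \<open>Put \<open>s\<^sub>j = \<parallel>(1/x\<^sub>i)\<^sub>i\<^sub>\<ge>\<^sub>j\<parallel>\<^sup>-\<^sup>1\<close> for the norm given by \<open>N\<^sub>j\<close>, so that \<open>\<Sum>\<^sub>i\<^sub>\<ge>\<^sub>j N(s/x\<^sub>i)\<close> crosses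
  \<open>(k - j + 1)/(2e)\<close> at \<open>s = s\<^sub>j\<close>. The event \<open>\<bar>x\<^sub>i\<xi>\<^sub>i\<bar> \<le> t\<close> has probability \<open>1 - exp(-N(t/x\<^sub>i))\<close>,
  and \<open>k-min \<le> t\<close> means that at least \<open>k\<close> of these independent events occur.

  Lower estimate: if \<open>k-min \<le> s\<close>, then at least \<open>k - j + 1\<close> events with index \<open>\<ge> j\<close> occur. For
  \<open>s < s\<^sub>j\<close> their expected number is at most \<open>(k - j + 1)/(2e)\<close>, and Chernoff's bound makes this
  unlikely.

  Upper estimate: let \<open>s > max s\<^sub>j\<close>, \<open>t = 4ebs\<close> and \<open>y\<^sub>i = N(t/x\<^sub>i)\<close>, which decreases in \<open>i\<close>. Convexity
  gives \<open>\<Sum>\<^sub>i\<^sub>\<ge>\<^sub>j y\<^sub>i \<ge> 2b(k - j + 1)\<close> for all \<open>j \<le> k\<close>. Take the first \<open>j\<close> with \<open>y\<^sub>j < b\<close>. Each earlier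
  event fails with probability at most \<open>exp(-b)\<close>, and Chernoff's bound with base \<open>exp(-b)\<close> shows that
  fewer than \<open>k - j + 1\<close> of the remaining ones occur with probability at most \<open>exp(-b)\<close>. Hence
  \<open>P(k-min > 4ebs) \<le> k exp(-b)\<close>, which is summed over \<open>b \<in> 2 ln(k + 1) + \<nat>\<close>.\<close>

section \<open>Order statistics as counts\<close>

text \<open>The entries up to \<open>t\<close> form an initial segment of a sorted list, so position
  \<open>m\<close> belongs to it exactly when the segment is longer than \<open>m\<close>.\<close>

lemma sorted_nth_le_iff:
  assumes "sorted xs" and "m < length xs"
  shows "xs ! m \<le> t \<longleftrightarrow> m < length (filter (\<lambda>y. y \<le> t) xs)"
  using assms
proof (induction xs arbitrary: m)
  case Nil
  then show ?case by simp
next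
  case (Cons y ys)
  show ?case
  proof (cases "y \<le> t")
    case True
    then show ?thesis
      using Cons by (cases m) auto
  next
    case False
    then have "\<forall>v\<in>set (y # ys). \<not> v \<le> t"
      using Cons.prems(1) by auto
    moreover have "(y # ys) ! m \<in> set (y # ys)"
      using Cons.prems(2) by (intro nth_mem)
    moreover have "filter (\<lambda>v. v \<le> t) (y # ys) = []"
      using calculation(1) by (simp only: filter_empty_conv simp_thms)
    ultimately show ?thesis
      by (metis less_nat_zero_code list.size(3))
  qed
qed

text \<open>Turns the order statistic into a count of successes, the only form in which it is used
  later.\<close>

lemma k_min_le_iff:
  assumes "1 \<le> k" and "k \<le> n"
  shows "k_min k n a \<le> t \<longleftrightarrow> k \<le> card {i\<in>{1..n}. a i \<le> t}"
proof -
  let ?xs = "map a [1..<Suc n]"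
  have "length (filter (\<lambda>y. y \<le> t) (sort ?xs)) = length (filter (\<lambda>y. y \<le> t) ?xs)"
    by (simp only: filter_sort length_sort)
  also have "\<dots> = length (filter (\<lambda>i. a i \<le> t) [1..<Suc n])"
    by (simp add: filter_map o_def)
  also have "\<dots> = card (set (filter (\<lambda>i. a i \<le> t) [1..<Suc n]))"
    by (rule distinct_card[symmetric]) simp
  also have "set (filter (\<lambda>i. a i \<le> t) [1..<Suc n]) = {i\<in>{1..n}. a i \<le> t}"
    by auto
  finally have "length (filter (\<lambda>y. y \<le> t) (sort ?xs)) = card {i\<in>{1..n}. a i \<le> t}" .
  moreover have "k_min k n a \<le> t \<longleftrightarrow> k - 1 < length (filter (\<lambda>y. y \<le> t) (sort ?xs))"
    unfolding k_min_def using assms by (intro sorted_nth_le_iff sorted_sort) simp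
  ultimately show ?thesis
    using assms(1) by auto
qed

section \<open>Tail bounds for the number of independent successes\<close>

lemma (in prob_space) indep_vars_event:
  assumes "indep_vars N X I" and "i \<in> I" and "A \<in> sets (N i)"
  shows "{\<omega>\<in>space M. X i \<omega> \<in> A} \<in> events"
proof -
  have "X i \<in> measurable M (N i)"
    using assms(1,2) by (auto simp: indep_vars_def)
  then show ?thesis
    using assms(3) by measurable
qed

text \<open>The Chernoff bound for both tails: the event says \<open>card \<dots> \<ge> m\<close> if \<open>z > 1\<close> and \<open>card \<dots> \<le> m\<close> if
  \<open>z < 1\<close>.\<close>

lemma (in prob_space) prob_card_chernoff:
  fixes z :: real
  assumes indep: "indep_vars N X I" and fin: "finite I"
    and B: "\<And>i. i \<in> I \<Longrightarrow> B i \<in> sets (N i)" and z: "z > 0"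
  shows "prob {\<omega>\<in>space M. z ^ m \<le> z ^ card {i\<in>I. X i \<omega> \<in> B i}}
    \<le> (\<Prod>i\<in>I. 1 + (z - 1) * prob {\<omega>\<in>space M. X i \<omega> \<in> B i}) / z ^ m"
proof -
  \<comment> \<open>Equals \<open>z\<close> on \<open>B i\<close> and 1 elsewhere, so the product
    over \<open>I\<close> is \<open>z\<close> to the number of successes; independence factors its
    expectation, and Markov's inequality concludes.\<close>
  define g where "g i v = 1 + (z - 1) * indicat_real (B i) v" for i v
  have g: "g i \<in> borel_measurable (N i)" if "i \<in> I" for i
    using B[OF that] unfolding g_def by measurable
  have gX: "indep_vars (\<lambda>_. borel) (\<lambda>i \<omega>. g i (X i \<omega>)) I"
    using indep g by (rule indep_vars_compose2)
  have ev: "{\<omega>\<in>space M. X i \<omega> \<in> B i} \<in> events" if "i \<in> I" for i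
    using indep that B[OF that] by (rule indep_vars_event)
  have g_eq: "g i (X i \<omega>) = 1 + (z - 1) * indicat_real {\<omega>\<in>space M. X i \<omega> \<in> B i} \<omega>"
    if "\<omega> \<in> space M" for i \<omega>
    using that by (simp add: g_def indicator_def)
  have int: "integrable M (\<lambda>\<omega>. g i (X i \<omega>))" if "i \<in> I" for i
  proof -
    have "integrable M (\<lambda>\<omega>. 1 + (z - 1) * indicat_real {\<omega>\<in>space M. X i \<omega> \<in> B i} \<omega>)"
      using ev[OF that] by (intro Bochner_Integration.integrable_add integrable_mult_right)
        (auto simp: integrable_indicator_iff emeasure_eq_measure)
    then show ?thesis
      by (subst Bochner_Integration.integrable_cong[OF refl g_eq])
  qed
  have exp_g: "expectation (\<lambda>\<omega>. g i (X i \<omega>)) = 1 + (z - 1) * prob {\<omega>\<in>space M. X i \<omega> \<in> B i}"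
    if "i \<in> I" for i
  proof -
    have "expectation (\<lambda>\<omega>. g i (X i \<omega>))
        = expectation (\<lambda>\<omega>. 1 + (z - 1) * indicat_real {\<omega>\<in>space M. X i \<omega> \<in> B i} \<omega>)"
      by (intro Bochner_Integration.integral_cong refl g_eq)
    also have "\<dots> = 1 + (z - 1) * prob {\<omega>\<in>space M. X i \<omega> \<in> B i}"
      using ev[OF that]
      by (subst Bochner_Integration.integral_add)
         (auto simp: integrable_indicator_iff emeasure_eq_measure prob_space intro!: integrable_mult_right)
    finally show ?thesis .
  qed
  have prod_eq: "(\<Prod>i\<in>I. g i (X i \<omega>)) = z ^ card {i\<in>I. X i \<omega> \<in> B i}" for \<omega>
  proof -
    have "(\<Prod>i\<in>I. g i (X i \<omega>)) = (\<Prod>i\<in>I. if X i \<omega> \<in> B i then z else 1)"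
      by (intro prod.cong) (auto simp: g_def)
    also have "\<dots> = z ^ card {i\<in>I. X i \<omega> \<in> B i}"
      using fin by (simp flip: prod.inter_filter)
    finally show ?thesis .
  qed
  have "prob {\<omega>\<in>space M. z ^ m \<le> (\<Prod>i\<in>I. g i (X i \<omega>))}
      \<le> expectation (\<lambda>\<omega>. \<Prod>i\<in>I. g i (X i \<omega>)) / z ^ m"
    using z indep_vars_integrable[OF fin gX int]
    by (intro integral_Markov_inequality_measure[where A = "{}"]) (auto simp: prod_eq)
  also have "expectation (\<lambda>\<omega>. \<Prod>i\<in>I. g i (X i \<omega>)) = (\<Prod>i\<in>I. expectation (\<lambda>\<omega>. g i (X i \<omega>)))"
    using indep_vars_lebesgue_integral[OF fin gX int] .
  finally show ?thesis
    by (simp add: prod_eq exp_g)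
qed


text \<open>The count is a finite sum of measurable indicators. The free predicate \<open>Q\<close>
  serves both tails.\<close>

lemma (in prob_space) events_card:
  assumes "indep_vars N X I" and "finite I" and "\<And>i. i \<in> I \<Longrightarrow> B i \<in> sets (N i)"
  shows "{\<omega>\<in>space M. Q (card {i\<in>I. X i \<omega> \<in> B i})} \<in> events"
proof -
  have ev: "{\<omega>\<in>space M. X i \<omega> \<in> B i} \<in> events" if "i \<in> I" for i
    using assms(1) that assms(3)[OF that] by (rule indep_vars_event)
  have eq: "card {i\<in>I. X i \<omega> \<in> B i} = (\<Sum>i\<in>I. if X i \<omega> \<in> B i then 1 else 0)" for \<omega>
    using assms(2) by (simp flip: sum.inter_filter)
  have "(\<lambda>\<omega>. if X i \<omega> \<in> B i then 1 else 0 :: nat) \<in> measurable M (count_space UNIV)" if "i \<in> I" for i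
    using ev[OF that] by (intro measurable_If) auto
  then have "(\<lambda>\<omega>. card {i\<in>I. X i \<omega> \<in> B i}) \<in> measurable M (count_space UNIV)"
    unfolding eq by (intro measurable_sum_nat) auto
  then show ?thesis
    by measurable
qed

text \<open>Chernoff with base \<open>2 * exp 1\<close> bounds the numerator by
  \<open>exp (real l)\<close>, whose factors \<open>exp 1\<close> cancel against the base and leave
  \<open>(1 / 2) ^ l\<close>. For \<open>l = 1\<close> a union bound is sharper. In the lower
  estimate, 1/4 leaves probability 3/4.\<close>

lemma (in prob_space) prob_card_ge_le_quarter:
  fixes y :: "'i \<Rightarrow> real"
  assumes indep: "indep_vars N X I" and fin: "finite I"
    and B: "\<And>i. i \<in> I \<Longrightarrow> B i \<in> sets (N i)"
    and p: "\<And>i. i \<in> I \<Longrightarrow> prob {\<omega>\<in>space M. X i \<omega> \<in> B i} \<le> y i"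
    and l: "l \<ge> 1" and y: "sum y I \<le> real l / (2 * exp 1)"
  shows "prob {\<omega>\<in>space M. l \<le> card {i\<in>I. X i \<omega> \<in> B i}} \<le> 1 / 4"
proof -
  have e: "exp 1 \<ge> (2::real)"
    using exp_ge_add_one_self[of "1::real"] by simp
  have ev: "{\<omega>\<in>space M. X i \<omega> \<in> B i} \<in> events" if "i \<in> I" for i
    using indep that B[OF that] by (rule indep_vars_event)
  show ?thesis
  proof (cases "l = 1")
    case True
    have "{\<omega>\<in>space M. l \<le> card {i\<in>I. X i \<omega> \<in> B i}} = (\<Union>i\<in>I. {\<omega>\<in>space M. X i \<omega> \<in> B i})"
      using fin by (auto simp: True Suc_le_eq card_gt_0_iff)
    then have "prob {\<omega>\<in>space M. l \<le> card {i\<in>I. X i \<omega> \<in> B i}} \<le> (\<Sum>i\<in>I. prob {\<omega>\<in>space M. X i \<omega> \<in> B i})"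
      using ev by (simp only:) (intro finite_measure_subadditive_finite fin, auto)
    also have "\<dots> \<le> sum y I"
      by (intro sum_mono p)
    also have "\<dots> \<le> 1 / (2 * exp 1)"
      using y True by simp
    also have "\<dots> \<le> 1 / 4"
      using e by (simp add: field_simps)
    finally show ?thesis .
  next
    case False
    \<comment> \<open>Chernoff with base \<open>z\<close> gives only \<open>2\<^sup>-\<^sup>l\<close>, too weak for \<open>l = 1\<close>.\<close>
    define z :: real where "z = 2 * exp 1"
    have z: "z \<ge> 4"
      using e by (simp add: z_def)
    have "prob {\<omega>\<in>space M. l \<le> card {i\<in>I. X i \<omega> \<in> B i}}
        = prob {\<omega>\<in>space M. z ^ l \<le> z ^ card {i\<in>I. X i \<omega> \<in> B i}}"
      using z by (simp add: power_increasing_iff)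
    also have "\<dots> \<le> (\<Prod>i\<in>I. 1 + (z - 1) * prob {\<omega>\<in>space M. X i \<omega> \<in> B i}) / z ^ l"
      using z by (intro prob_card_chernoff[OF indep fin B]) auto
    also have "\<dots> \<le> (\<Prod>i\<in>I. exp ((z - 1) * y i)) / z ^ l"
    proof (intro divide_right_mono prod_mono conjI)
      fix i assume "i \<in> I"
      have "1 + (z - 1) * prob {\<omega>\<in>space M. X i \<omega> \<in> B i} \<le> 1 + (z - 1) * y i"
        using z p[OF \<open>i \<in> I\<close>] by simp
      also have "\<dots> \<le> exp ((z - 1) * y i)"
        by (rule exp_ge_add_one_self)
      finally show "1 + (z - 1) * prob {\<omega>\<in>space M. X i \<omega> \<in> B i} \<le> exp ((z - 1) * y i)" .
    qed (use z in auto)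
    also have "\<dots> = exp ((z - 1) * sum y I) / z ^ l"
      by (simp add: exp_sum[OF fin] sum_distrib_left)
    also have "\<dots> \<le> exp (real l) / z ^ l"
    proof -
      have "(z - 1) * sum y I \<le> (z - 1) * (real l / z)"
        using y z by (intro mult_left_mono) (auto simp: z_def)
      also have "\<dots> \<le> real l"
        using z by (simp add: field_simps)
      finally show ?thesis
        using z by (intro divide_right_mono) auto
    qed
    also have "\<dots> = (1 / 2) ^ l"
      by (simp add: z_def power_mult_distrib power_divide exp_of_nat_mult[of l 1, simplified])
    \<comment> \<open>Only \<open>l \<ge> 2\<close> is left in this case.\<close>
    also have "\<dots> \<le> (1 / 2) ^ 2"
      using l False by (intro power_decreasing) auto
    finally show ?thesis
      by (simp add: power2_eq_square)
  qed
qed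

text \<open>The base \<open>z = exp (- b)\<close> makes each Chernoff factor at most
  \<open>exp (- y i / 2)\<close>, so the product is at most \<open>exp (- (b * real l))\<close>;
  dividing by \<open>z ^ (l - 1)\<close> leaves a single \<open>exp (- b)\<close>.\<close>

lemma (in prob_space) prob_card_less_le:
  fixes y :: "'i \<Rightarrow> real"
  assumes indep: "indep_vars N X I" and fin: "finite I"
    and B: "\<And>i. i \<in> I \<Longrightarrow> B i \<in> sets (N i)"
    and p: "\<And>i. i \<in> I \<Longrightarrow> prob {\<omega>\<in>space M. X i \<omega> \<in> B i} = 1 - exp (- y i)"
    and yb: "\<And>i. i \<in> I \<Longrightarrow> 0 \<le> y i \<and> y i \<le> b" and b: "b \<ge> 2 * ln 2"
    and l: "l \<ge> 1" and y: "2 * b * real l \<le> sum y I"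
  shows "prob {\<omega>\<in>space M. card {i\<in>I. X i \<omega> \<in> B i} < l} \<le> exp (- b)"
proof -
  define z where "z = exp (- b)"
  have "z \<le> exp (- (2 * ln 2))"
    using b by (simp add: z_def)
  also have "\<dots> = 1 / 4"
    by (simp add: exp_minus exp_double field_simps)
  finally have z: "0 < z" "z \<le> 1 / 4"
    by (auto simp: z_def)
  \<comment> \<open>With \<open>w = exp(-v/2)\<close> this says \<open>(1 - z)w\<^sup>2 + z \<le> w\<close>, that is \<open>(1 - w)((1 - z)w - z) \<ge> 0\<close>,
    and \<open>w \<ge> sqrt z \<ge> 2z\<close>.\<close>
  have factor: "1 + (z - 1) * (1 - exp (- v)) \<le> exp (- v / 2)" if v: "0 \<le> v" "v \<le> b" for v
  proof -
    define w where "w = exp (- v / 2)"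
    have ww: "exp (- v) = w * w"
      by (simp add: w_def flip: exp_add)
    \<comment> \<open>The cap \<open>v \<le> b\<close> gives \<open>z \<le> w * w\<close>.\<close>
    have w: "0 < w" "w \<le> 1" "z \<le> w * w"
      using v by (auto simp: w_def z_def simp flip: exp_add)
    have "z \<le> (1 - z) * w"
    proof -
      have "(4 * z)\<^sup>2 \<le> 4 * z"
        using z by (simp add: power2_eq_square)
      also have "\<dots> \<le> (2 * w)\<^sup>2"
        using w by (simp add: power2_eq_square)
      finally have "(4 * z)\<^sup>2 \<le> (2 * w)\<^sup>2" .
      then have "4 * z \<le> 2 * w"
        by (rule power2_le_imp_le) (use w in simp)
      moreover have "3 / 4 * w \<le> (1 - z) * w"
        using z w by (intro mult_right_mono) auto
      ultimately show ?thesis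
        using w by linarith
    qed
    then have "0 \<le> (1 - w) * ((1 - z) * w - z)"
      using w by (intro mult_nonneg_nonneg) auto
    then show ?thesis
      unfolding ww w_def[symmetric] by (simp add: algebra_simps)
  qed
  have "prob {\<omega>\<in>space M. card {i\<in>I. X i \<omega> \<in> B i} < l}
      = prob {\<omega>\<in>space M. z ^ (l - 1) \<le> z ^ card {i\<in>I. X i \<omega> \<in> B i}}"
  proof -
    \<comment> \<open>A base below 1 reverses the order, and \<open>card S < l\<close> means
      \<open>card S \<le> l - 1\<close>.\<close>
    have "card S < l \<longleftrightarrow> z ^ (l - 1) \<le> z ^ card S" for S :: "'i set"
      using z l by (subst power_decreasing_iff) auto
    then show ?thesis
      by simp
  qed
  also have "\<dots> \<le> (\<Prod>i\<in>I. 1 + (z - 1) * prob {\<omega>\<in>space M. X i \<omega> \<in> B i}) / z ^ (l - 1)"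
    using z by (intro prob_card_chernoff[OF indep fin B]) auto
  also have "\<dots> \<le> (\<Prod>i\<in>I. exp (- y i / 2)) / z ^ (l - 1)"
  proof (intro divide_right_mono prod_mono conjI)
    fix i assume i: "i \<in> I"
    show "0 \<le> 1 + (z - 1) * prob {\<omega>\<in>space M. X i \<omega> \<in> B i}"
      using mult_mono[of "1 - z" 1 "prob {\<omega>\<in>space M. X i \<omega> \<in> B i}" 1] z
      by (simp add: algebra_simps)
    show "1 + (z - 1) * prob {\<omega>\<in>space M. X i \<omega> \<in> B i} \<le> exp (- y i / 2)"
      unfolding p[OF i] using yb[OF i] by (intro factor) auto
  qed (use z in auto)
  also have "(\<Prod>i\<in>I. exp (- y i / 2)) = exp (\<Sum>i\<in>I. - y i / 2)"
    by (rule exp_sum[OF fin, symmetric])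
  also have "(\<Sum>i\<in>I. - y i / 2) = - sum y I / 2"
    by (simp add: sum_divide_distrib sum_negf)
  also have "exp (- sum y I / 2) / z ^ (l - 1) \<le> exp (- (b * real l)) / z ^ (l - 1)"
    using y z by (intro divide_right_mono) auto
  also have "z ^ (l - 1) = exp (- (b * real (l - 1)))"
    unfolding z_def by (subst exp_of_nat_mult[symmetric]) (simp add: mult.commute)
  also have "exp (- (b * real l)) / exp (- (b * real (l - 1))) = exp (- b)"
    using l by (simp add: of_nat_diff algebra_simps flip: exp_diff)
  finally show ?thesis .
qed

text \<open>Since \<open>prob_card_less_le\<close> needs \<open>y i \<le> b\<close>, the initial
  stretch with \<open>y i \<ge> b\<close>, cut at \<open>k\<close>, is split off and costs at most
  \<open>exp (- b)\<close> per index by a union bound. The rest costs one more such term, and only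
  if \<open>J \<le> k\<close>.\<close>

lemma (in prob_space) prob_card_less_le_nested:
  fixes y :: "nat \<Rightarrow> real"
  assumes indep: "indep_vars N X {1..n}"
    and B: "\<And>i. i \<in> {1..n} \<Longrightarrow> B i \<in> sets (N i)"
    and p: "\<And>i. i \<in> {1..n} \<Longrightarrow> prob {\<omega>\<in>space M. X i \<omega> \<in> B i} = 1 - exp (- y i)"
    and y0: "\<And>i. i \<in> {1..n} \<Longrightarrow> 0 \<le> y i" and anti: "antimono_on {1..n} y"
    and b: "b \<ge> 2 * ln 2" and k: "1 \<le> k" "k \<le> n"
    and y: "\<And>j. j \<in> {1..k} \<Longrightarrow> 2 * b * (real k - real j + 1) \<le> sum y {j..n}"
  shows "prob {\<omega>\<in>space M. card {i\<in>{1..n}. X i \<omega> \<in> B i} < k} \<le> real k * exp (- b)"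
proof -
  let ?S = "\<lambda>I \<omega>. {i\<in>I. X i \<omega> \<in> B i}"
  \<comment> \<open>The default \<open>k + 1\<close> stands for the case that \<open>y 1\<close>,
    ..., \<open>y k\<close> are all at least \<open>b\<close>.\<close>
  define J where "J = (LEAST j. j = k + 1 \<or> (1 \<le> j \<and> y j < b))"
  have J: "J = k + 1 \<or> (1 \<le> J \<and> y J < b)"
    unfolding J_def by (rule LeastI[of _ "k + 1"]) simp
  have Jk: "J \<le> k + 1"
    unfolding J_def by (rule Least_le) simp
  have J1: "1 \<le> J"
    using J by auto
  have small: "b \<le> y i" if "1 \<le> i" "i < J" for i
    using not_less_Least[of i "\<lambda>j. j = k + 1 \<or> (1 \<le> j \<and> y j < b)"] that unfolding J_def[symmetric]
    by auto
  have ev: "{\<omega>\<in>space M. X i \<omega> \<notin> B i} \<in> events"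
    and pc: "prob {\<omega>\<in>space M. X i \<omega> \<notin> B i} = exp (- y i)" if "i \<in> {1..n}" for i
  proof -
    have *: "{\<omega>\<in>space M. X i \<omega> \<in> B i} \<in> events"
      using indep that B[OF that] by (rule indep_vars_event)
    have eq: "{\<omega>\<in>space M. X i \<omega> \<notin> B i} = space M - {\<omega>\<in>space M. X i \<omega> \<in> B i}"
      by auto
    show "{\<omega>\<in>space M. X i \<omega> \<notin> B i} \<in> events"
      unfolding eq using * by auto
    show "prob {\<omega>\<in>space M. X i \<omega> \<notin> B i} = exp (- y i)"
      unfolding eq using prob_compl[OF *] p[OF that] by simp
  qed
  define A where "A = (\<Union>i\<in>{1..<J}. {\<omega>\<in>space M. X i \<omega> \<notin> B i})"
  \<comment> \<open>After \<open>J - 1\<close> earlier successes, \<open>k + 1 - J\<close> more are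
    needed to reach \<open>k\<close>.\<close>
  define D where "D = {\<omega>\<in>space M. card (?S {J..n} \<omega>) < k + 1 - J}"
  have indep': "indep_vars N X {J..n}"
    using J1 by (intro indep_vars_subset[OF indep]) auto
  have A_ev: "A \<in> events"
    using ev Jk k unfolding A_def by (intro sets.finite_UN) auto
  have D_ev: "D \<in> events"
    unfolding D_def using B J1 by (intro events_card[OF indep']) auto
  have "prob A \<le> (\<Sum>i\<in>{1..<J}. prob {\<omega>\<in>space M. X i \<omega> \<notin> B i})"
    unfolding A_def using ev Jk k by (intro finite_measure_subadditive_finite) auto
  also have "\<dots> \<le> (\<Sum>i\<in>{1..<J}. exp (- b))"
    using pc small Jk k by (intro sum_mono) auto
  finally have PA: "prob A \<le> (real J - 1) * exp (- b)"
    using J1 by (simp add: of_nat_diff)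
  have sub: "{\<omega>\<in>space M. card (?S {1..n} \<omega>) < k} \<subseteq> A \<union> D"
  proof (clarify)
    fix \<omega> assume \<omega>: "\<omega> \<in> space M" "card (?S {1..n} \<omega>) < k" "\<omega> \<notin> D"
    show "\<omega> \<in> A"
    proof (rule ccontr)
      assume "\<omega> \<notin> A"
      then have "X i \<omega> \<in> B i" if "i \<in> {1..<J}" for i
        using \<omega>(1) that unfolding A_def by auto
      moreover have "{1..n} = {1..<J} \<union> {J..n}"
        using Jk k J1 by auto
      ultimately have "?S {1..n} \<omega> = {1..<J} \<union> ?S {J..n} \<omega>"
        by auto
      moreover have "card ({1..<J} \<union> ?S {J..n} \<omega>) = card {1..<J} + card (?S {J..n} \<omega>)"
        by (rule card_Un_disjoint) auto
      ultimately have "card (?S {1..n} \<omega>) = (J - 1) + card (?S {J..n} \<omega>)"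
        by simp
      then show False
        using \<omega> Jk J1 by (auto simp: D_def)
    qed
  qed
  show ?thesis
  proof (cases "J = k + 1")
    case True
    \<comment> \<open>No further success is required, as the threshold \<open>k + 1 - J\<close> is
      0.\<close>
    then have "D = {}"
      by (simp add: D_def)
    then have "prob {\<omega>\<in>space M. card (?S {1..n} \<omega>) < k} \<le> prob A"
      using sub A_ev by (intro finite_measure_mono) auto
    then show ?thesis
      using PA True by simp
  next
    case False
    then have Jk': "J \<le> k" and yJ: "y J < b"
      using J Jk by auto
    have "prob D \<le> exp (- b)"
      unfolding D_def
    proof (rule prob_card_less_le[OF indep'])
      \<comment> \<open>By monotonicity \<open>y J < b\<close> caps all later
        \<open>y i\<close>.\<close>
      show "0 \<le> y i \<and> y i \<le> b" if "i \<in> {J..n}" for i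
        using y0[of i] monotone_onD[OF anti, of J i] that yJ J1 by auto
      show "2 * b * real (k + 1 - J) \<le> sum y {J..n}"
        using y[of J] J1 Jk' by (simp add: of_nat_diff algebra_simps)
    qed (use B p b J1 Jk' in auto)
    moreover have "prob {\<omega>\<in>space M. card (?S {1..n} \<omega>) < k} \<le> prob (A \<union> D)"
      using sub A_ev D_ev by (intro finite_measure_mono) auto
    moreover have "prob (A \<union> D) \<le> prob A + prob D"
      using A_ev D_ev by (rule measure_Un_le)
    ultimately have "prob {\<omega>\<in>space M. card (?S {1..n} \<omega>) < k} \<le> real J * exp (- b)"
      using PA by (simp add: algebra_simps)
    also have "\<dots> \<le> real k * exp (- b)"
      using Jk' by simp
    finally show ?thesis .
  qed
qed

section \<open>From exponential tails to expectations\<close>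

text \<open>The factor 2 majorises \<open>\<Sum>\<^sub>r exp(-r)\<close>.\<close>

lemma (in prob_space) nn_integral_le_of_exp_tail:
  fixes f :: "'a \<Rightarrow> real"
  assumes c: "c > 0" and b: "b \<ge> 0" and K: "K \<ge> 0"
    and ev: "\<And>r :: nat. {\<omega>\<in>space M. f \<omega> > c * (b + r)} \<in> events"
    and tail: "\<And>r :: nat. prob {\<omega>\<in>space M. f \<omega> > c * (b + r)} \<le> K * exp (- (b + r))"
  shows "(\<integral>\<^sup>+ \<omega>. ennreal (f \<omega>) \<partial>M) \<le> ennreal (c * (b + 2 * K * exp (- b)))"
proof -
  define A where "A r = {\<omega>\<in>space M. f \<omega> > c * (b + real r)}" for r :: nat
  have [measurable]: "A r \<in> events" for r
    using ev by (simp add: A_def)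
  have pointwise: "ennreal (f \<omega>) \<le> ennreal (c * b) + ennreal c * (\<Sum>r. indicator (A r) \<omega>)"
    if \<omega>: "\<omega> \<in> space M" for \<omega>
  proof -
    \<comment> \<open>\<open>R\<close> counts the levels exceeded by \<open>f \<omega>\<close>: the
      ceiling makes \<open>c * b + c * R\<close> an upper bound while
      \<open>\<omega> \<in> A r\<close> for every \<open>r < R\<close>. It is 0 when
      \<open>f \<omega> \<le> c * b\<close>.\<close>
    define R where "R = nat \<lceil>(f \<omega> - c * b) / c\<rceil>"
    have R: "f \<omega> \<le> c * b + c * real R"
      using real_nat_ceiling_ge[of "(f \<omega> - c * b) / c"] c by (simp add: R_def field_simps)
    have "\<omega> \<in> A r" if "r < R" for r
    proof -
      have "int r < \<lceil>(f \<omega> - c * b) / c\<rceil>"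
        using that by (simp add: R_def zless_nat_eq_int_zless)
      then have "real r < (f \<omega> - c * b) / c"
        by (simp add: less_ceiling_iff)
      then show ?thesis
        using c \<omega> by (simp add: A_def field_simps)
    qed
    then have "of_nat R = (\<Sum>r<R. indicator (A r) \<omega> :: ennreal)"
      by simp
    also have "\<dots> \<le> (\<Sum>r. indicator (A r) \<omega>)"
      by (intro sum_le_suminf) auto
    finally have "ennreal (c * b) + ennreal c * of_nat R \<le> ennreal (c * b) + ennreal c * (\<Sum>r. indicator (A r) \<omega>)"
      by (intro add_left_mono mult_left_mono) auto
    moreover have "ennreal (f \<omega>) \<le> ennreal (c * b) + ennreal c * of_nat R"
    proof -
      have "ennreal (f \<omega>) \<le> ennreal (c * b + c * real R)"
        using R by (rule ennreal_leI)
      also have "\<dots> = ennreal (c * b) + ennreal c * of_nat R"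
        using c b by (simp add: ennreal_mult ennreal_of_nat_eq_real_of_nat)
      finally show ?thesis .
    qed
    ultimately show ?thesis
      by (rule order_trans[rotated])
  qed
  have "(\<integral>\<^sup>+ \<omega>. ennreal (f \<omega>) \<partial>M) \<le> (\<integral>\<^sup>+ \<omega>. ennreal (c * b) + ennreal c * (\<Sum>r. indicator (A r) \<omega>) \<partial>M)"
    by (intro nn_integral_mono pointwise)
  also have "\<dots> = ennreal (c * b) + ennreal c * (\<Sum>r. emeasure M (A r))"
    by (simp add: nn_integral_add nn_integral_cmult nn_integral_suminf emeasure_space_1)
  also have "(\<Sum>r. emeasure M (A r)) \<le> (\<Sum>r. ennreal (K * exp (- b) * (1 / 2) ^ r))"
  proof (rule suminf_le)
    fix r
    have "exp (- real r) \<le> (1 / 2) ^ r"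
    proof -
      have "exp (- 1) \<le> (1 / 2 :: real)"
        using exp_ge_add_one_self[of "1::real"] by (simp add: exp_minus field_simps)
      then have "exp (- 1) ^ r \<le> (1 / 2 :: real) ^ r"
        by (intro power_mono) auto
      then show ?thesis
        by (simp flip: exp_of_nat_mult)
    qed
    then have "K * exp (- b) * exp (- real r) \<le> K * exp (- b) * (1 / 2) ^ r"
      using K by (intro mult_left_mono) auto
    moreover have "prob (A r) \<le> K * exp (- b) * exp (- real r)"
      using tail[of r] by (simp only: A_def minus_add_distrib exp_add mult.assoc)
    ultimately have "prob (A r) \<le> K * exp (- b) * (1 / 2) ^ r"
      by linarith
    then show "emeasure M (A r) \<le> ennreal (K * exp (- b) * (1 / 2) ^ r)"
      by (simp only: emeasure_eq_measure ennreal_leI)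
  qed auto
  also have "(\<Sum>r. ennreal (K * exp (- b) * (1 / 2) ^ r)) = ennreal (2 * K * exp (- b))"
  proof -
    have "(\<lambda>r. K * exp (- b) * (1 / 2) ^ r) sums (K * exp (- b) * (1 / (1 - 1 / 2)))"
      by (intro sums_mult geometric_sums) simp
    then show ?thesis
      using K by (subst suminf_ennreal_eq) (auto simp: mult_ac)
  qed
  finally show ?thesis
    using c b K by (simp add: add_left_mono mult_left_mono flip: ennreal_plus ennreal_mult)
      (simp add: algebra_simps)
qed

section \<open>The inverse of the Orlicz norm\<close>

lemma ennreal_inverse_antimono:
  fixes a b :: ennreal
  assumes "a \<le> b"
  shows "inverse b \<le> inverse a"
  using assms
  by (cases a; cases b; cases "a = 0"; cases "b = 0") (auto simp: inverse_ennreal ennreal_le_iff top_unique)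

text \<open>With \<open>s = 1 / \<rho>\<close> the inverse norm is the supremum of the admissible
  \<open>s\<close>, so a bound valid for each admissible \<open>s\<close> passes to it.\<close>

lemma inverse_orlicz_norm_le:
  assumes c: "c > 0"
    and le: "\<And>s. s > 0 \<Longrightarrow> (\<Sum>i\<in>I. M (\<bar>x i\<bar> * s)) \<le> 1 \<Longrightarrow> ennreal (c * s) \<le> E"
  shows "ennreal c * inverse (orlicz_norm M I x) \<le> E"
proof (cases E)
  case top
  then show ?thesis by simp
next
  case (real e)
  define A where "A = {\<rho>::real. \<rho> > 0 \<and> (\<Sum>i\<in>I. M (\<bar>x i\<bar> / \<rho>)) \<le> 1}"
  have norm: "orlicz_norm M I x = (INF \<rho>\<in>A. ennreal \<rho>)"
    by (simp add: orlicz_norm_def A_def)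
  have A: "0 < \<rho> \<and> c / \<rho> \<le> e" if "\<rho> \<in> A" for \<rho>
    using le[of "1 / \<rho>"] that real c by (simp add: A_def)
  show ?thesis
  proof (cases "e = 0")
    case True
    \<comment> \<open>A positive \<open>c / \<rho>\<close> cannot be at most 0, so no
      \<open>\<rho>\<close> is admissible: the norm is \<open>\<infinity>\<close> and its inverse
      0.\<close>
    have "\<rho> \<notin> A" for \<rho>
      using A[of \<rho>] c True by (auto simp: field_simps)
    then have "A = {}"
      by blast
    then show ?thesis
      by (simp add: norm)
  next
    case False
    then have e: "e > 0"
      using real by simp
    have "ennreal (c / e) \<le> orlicz_norm M I x"
      unfolding norm
    proof (intro INF_greatest ennreal_leI)
      fix \<rho> assume "\<rho> \<in> A"
      then have "0 < \<rho>" and "c / \<rho> \<le> e"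
        using A by auto
      then show "c / e \<le> \<rho>"
        using e by (simp add: divide_le_eq mult.commute)
    qed
    then have "inverse (orlicz_norm M I x) \<le> inverse (ennreal (c / e))"
      by (rule ennreal_inverse_antimono)
    then have "ennreal c * inverse (orlicz_norm M I x) \<le> ennreal c * inverse (ennreal (c / e))"
      by (rule mult_left_mono) simp
    also have "\<dots> = E"
      using c e real by (simp add: inverse_ennreal flip: ennreal_mult)
    finally show ?thesis .
  qed
qed

text \<open>Otherwise \<open>1 / s\<close> would be admissible and bound the norm from
  above.\<close>

lemma inverse_orlicz_norm_less:
  assumes s: "s > 0" and less: "inverse (orlicz_norm M I x) < ennreal s"
  shows "1 < (\<Sum>i\<in>I. M (\<bar>x i\<bar> * s))"
proof (rule ccontr)
  assume "\<not> 1 < (\<Sum>i\<in>I. M (\<bar>x i\<bar> * s))"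
  then have "orlicz_norm M I x \<le> ennreal (1 / s)"
    unfolding orlicz_norm_def using s by (intro INF_lower2[of "1 / s"]) auto
  then have "inverse (ennreal (1 / s)) \<le> inverse (orlicz_norm M I x)"
    by (rule ennreal_inverse_antimono)
  then show False
    using less s by (simp add: inverse_ennreal)
qed

section \<open>The two-sided estimate for the expected order statistic\<close>

theorem theorem1:
  fixes M :: "'a measure" and \<xi> :: "nat \<Rightarrow> 'a \<Rightarrow> real"
    and P :: "'b measure" and X :: "'b \<Rightarrow> real"
    and n k :: nat and F N :: "real \<Rightarrow> real" and x :: "nat \<Rightarrow> real"
    and c\<^sub>1 C\<^sub>N :: real and N' :: "nat \<Rightarrow> real \<Rightarrow> real" and m E :: ennreal
  defines "c\<^sub>1 \<equiv> 1 - 1 / sqrt (2 * pi)"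
    and "C\<^sub>N \<equiv> max (N 1) (1 / N 1)"
    and "N' \<equiv> \<lambda>j t. 2 * exp 1 / (real k - real j + 1) * N t"
    and "m \<equiv> MAX j\<in>{1..k}. inverse (orlicz_norm (\<lambda>t. ennreal (N' j t)) {j..n} (\<lambda>i. 1 / x i))"
    and "E \<equiv> \<integral>\<^sup>+ \<omega>. ennreal (k_min k n (\<lambda>i. \<bar>x i * \<xi> i \<omega>\<bar>)) \<partial>M"
  assumes "1 \<le> k" and "real k \<le> real n / 2"
    and "prob_space P" and "X \<in> borel_measurable P"
    and "prob_space M" and "prob_space.indep_vars M (\<lambda>_. borel) \<xi> {1..n}"
    and "\<And>i. i \<in> {1..n} \<Longrightarrow> distr M borel (\<xi> i) = distr P borel X"
    and "\<And>t. t \<ge> 0 \<Longrightarrow> F t = measure P {\<omega> \<in> space P. \<bar>X \<omega>\<bar> > t}"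
    and "strict_antimono_on {0..} F" and "F 0 = 1"
    and "\<And>t. t \<ge> 0 \<Longrightarrow> N t = ln (1 / F t)"
    and "\<And>i. i \<in> {1..n} \<Longrightarrow> x i > 0" and "mono_on {1..n} x"
  shows "(convex_on {0..} N \<longrightarrow>
            ennreal c\<^sub>1 * m \<le> E \<and> E \<le> ennreal (16 * (exp 1)\<^sup>2 * C\<^sub>N * ln (real k + 1)) * m) \<and>
         ennreal c\<^sub>1 * m \<le> E"
proof -
  interpret P: prob_space P by fact
  interpret prob_space M by fact
  have k: "1 \<le> k" "k \<le> n"
    using assms(6,7) by auto
  have e: "exp 1 \<ge> (2::real)"
    using exp_ge_add_one_self[of "1::real"] by simp
  have ln_2: "1 / 2 \<le> ln (2::real)"
    using ln_le_minus_one[of "1 / 2 :: real"] by (simp add: ln_div)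
  have F_anti: "F t < F s" if "0 \<le> s" "s < t" for s t
    using monotone_onD[OF assms(14), of s t] that by simp
  \<comment> \<open>Strict decrease gives \<open>F t > F (t + 1) \<ge> 0\<close>, so the logarithm
    in \<open>N\<close> has a positive argument.\<close>
  have F_pos: "F t > 0" if "t \<ge> 0" for t
    using F_anti[of t "t + 1"] assms(13)[of "t + 1"] that
    by (smt (verit) measure_nonneg)
  have N_exp: "exp (- N t) = F t" if "t \<ge> 0" for t
    using assms(16)[OF that] F_pos[OF that] by (simp add: ln_div)
  have N_0: "N 0 = 0"
    using assms(16)[of 0] assms(15) by simp
  have N_mono: "N s \<le> N t" if "0 \<le> s" "s \<le> t" for s t
  proof (cases "s = t")
    case False
    then have "exp (- N t) < exp (- N s)"
      using N_exp[of s] N_exp[of t] F_anti[of s t] that by simp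
    then show ?thesis
      by simp
  qed simp
  have N_nonneg: "N t \<ge> 0" if "t \<ge> 0" for t
    using N_mono[of 0 t] N_0 that by simp
  have x: "x i > 0" if "i \<in> {1..n}" for i
    using assms(17) that .

  \<comment> \<open>The success events and their probabilities\<close>
  define B where "B t i = {v. \<bar>v\<bar> \<le> t / x i}" for t i
  have B_iff: "\<bar>x i * \<xi> i \<omega>\<bar> \<le> t \<longleftrightarrow> \<xi> i \<omega> \<in> B t i" if "i \<in> {1..n}" for t i \<omega>
    using x[OF that] by (simp add: B_def abs_mult pos_le_divide_eq mult.commute)
  have B_sets: "B t i \<in> sets borel" for t i
    by (simp add: B_def)
  have prob_B: "prob {\<omega>\<in>space M. \<xi> i \<omega> \<in> B t i} = 1 - exp (- N (t / x i))"
    if i: "i \<in> {1..n}" and t: "t \<ge> 0" for i t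
  proof -
    have tx: "t / x i \<ge> 0"
      using t x[OF i] by simp
    have \<xi>: "\<xi> i \<in> borel_measurable M"
      using assms(11) i by (auto simp: indep_vars_def)
    have "prob {\<omega>\<in>space M. \<xi> i \<omega> \<in> B t i} = measure (distr M borel (\<xi> i)) (B t i)"
      using \<xi> B_sets by (subst measure_distr) (auto simp: vimage_def Int_def conj_commute)
    also have "\<dots> = measure (distr P borel X) (B t i)"
      using assms(12)[OF i] by simp
    also have "\<dots> = measure P {\<omega>\<in>space P. \<bar>X \<omega>\<bar> \<le> t / x i}"
      using assms(9) B_sets by (subst measure_distr) (auto simp: B_def vimage_def Int_def conj_commute)
    also have "{\<omega>\<in>space P. \<bar>X \<omega>\<bar> \<le> t / x i} = space P - {\<omega>\<in>space P. \<bar>X \<omega>\<bar> > t / x i}"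
      by auto
    also have "measure P \<dots> = 1 - F (t / x i)"
      using assms(9) by (subst P.prob_compl) (auto simp: assms(13)[OF tx])
    finally show ?thesis
      using N_exp[OF tx] by simp
  qed
  have k_min_le: "k_min k n (\<lambda>i. \<bar>x i * \<xi> i \<omega>\<bar>) \<le> t \<longleftrightarrow> k \<le> card {i\<in>{1..n}. \<xi> i \<omega> \<in> B t i}" for t \<omega>
  proof -
    have "{i\<in>{1..n}. \<bar>x i * \<xi> i \<omega>\<bar> \<le> t} = {i\<in>{1..n}. \<xi> i \<omega> \<in> B t i}"
      using B_iff by blast
    then show ?thesis
      using k_min_le_iff[OF k] by simp
  qed
  \<comment> \<open>At \<open>\<rho> = 1 / s\<close> the constraint in the \<open>j\<close>-th norm
    becomes a bound on the sum of the \<open>N (s / x i)\<close>.\<close>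
  have N'_sum: "(\<Sum>i\<in>{j..n}. ennreal (N' j (\<bar>1 / x i\<bar> * s)))
      = ennreal (2 * exp 1 / (real k - real j + 1) * (\<Sum>i\<in>{j..n}. N (s / x i)))"
    if j: "j \<in> {1..k}" and s: "s > 0" for j s
  proof -
    have "(\<Sum>i\<in>{j..n}. ennreal (N' j (\<bar>1 / x i\<bar> * s)))
        = (\<Sum>i\<in>{j..n}. ennreal (2 * exp 1 / (real k - real j + 1) * N (s / x i)))"
    proof (rule sum.cong)
      fix i assume "i \<in> {j..n}"
      then show "ennreal (N' j (\<bar>1 / x i\<bar> * s)) = ennreal (2 * exp 1 / (real k - real j + 1) * N (s / x i))"
        using x[of i] j by (simp add: N'_def)
    qed simp
    also have "\<dots> = ennreal (\<Sum>i\<in>{j..n}. 2 * exp 1 / (real k - real j + 1) * N (s / x i))"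
    proof (rule sum_ennreal)
      show "0 \<le> 2 * exp 1 / (real k - real j + 1) * N (s / x i)" if "i \<in> {j..n}" for i
        using x[of i] that j s by (intro mult_nonneg_nonneg N_nonneg) auto
    qed
    finally show ?thesis
      by (simp only: sum_distrib_left)
  qed

  \<comment> \<open>The lower estimate\<close>
  have lower_j: "ennreal c\<^sub>1 * inverse (orlicz_norm (\<lambda>t. ennreal (N' j t)) {j..n} (\<lambda>i. 1 / x i)) \<le> E"
    if j: "j \<in> {1..k}" for j
  proof (rule inverse_orlicz_norm_le)
    \<comment> \<open>The quarter bound yields 3/4, and \<open>c\<^sub>1\<close> lies below it
      because \<open>sqrt (2 * pi) \<le> 4\<close>.\<close>
    have "sqrt (2 * pi) \<le> 4"
      using pi_less_4 by (intro real_le_lsqrt) auto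
    moreover have "1 < sqrt (2 * pi)"
      using pi_gt3 by simp
    ultimately have c: "c\<^sub>1 \<le> 3 / 4" "c\<^sub>1 > 0"
      by (auto simp: c\<^sub>1_def field_simps)
    then show "c\<^sub>1 > 0"
      by simp
    fix s :: real
    assume s: "s > 0" and "(\<Sum>i\<in>{j..n}. ennreal (N' j (\<bar>1 / x i\<bar> * s))) \<le> 1"
    then have "2 * exp 1 / (real k - real j + 1) * (\<Sum>i\<in>{j..n}. N (s / x i)) \<le> 1"
      using N'_sum[OF j s] by simp
    then have sum: "(\<Sum>i\<in>{j..n}. N (s / x i)) \<le> real (k + 1 - j) / (2 * exp 1)"
      using j by (simp add: of_nat_diff field_simps)
    let ?C = "{\<omega>\<in>space M. k + 1 - j \<le> card {i\<in>{j..n}. \<xi> i \<omega> \<in> B s i}}"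
    let ?D = "{\<omega>\<in>space M. k \<le> card {i\<in>{1..n}. \<xi> i \<omega> \<in> B s i}}"
    have indep: "indep_vars (\<lambda>_. borel) \<xi> {j..n}"
      using j by (intro indep_vars_subset[OF assms(11)]) auto
    have p: "prob ?C \<le> 1 / 4"
    proof (rule prob_card_ge_le_quarter[OF indep _ B_sets _ _ sum])
      show "prob {\<omega>\<in>space M. \<xi> i \<omega> \<in> B s i} \<le> N (s / x i)" if "i \<in> {j..n}" for i
        using prob_B[of i s] exp_ge_add_one_self[of "- N (s / x i)"] that j s by simp
    qed (use j in auto)
    have D: "?D \<in> events"
      by (intro events_card[OF assms(11)] B_sets) simp
    have C: "?C \<in> events"
      by (intro events_card[OF indep] B_sets) simp
    \<comment> \<open>At most \<open>j - 1\<close> of the \<open>k\<close> successes have index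
      below \<open>j\<close>.\<close>
    have "?D \<subseteq> ?C"
    proof clarify
      fix \<omega> assume "k \<le> card {i\<in>{1..n}. \<xi> i \<omega> \<in> B s i}"
      also have "\<dots> \<le> card ({1..<j} \<union> {i\<in>{j..n}. \<xi> i \<omega> \<in> B s i})"
        by (intro card_mono) auto
      also have "\<dots> \<le> card {1..<j} + card {i\<in>{j..n}. \<xi> i \<omega> \<in> B s i}"
        by (rule card_Un_le)
      finally have "k \<le> (j - 1) + card {i\<in>{j..n}. \<xi> i \<omega> \<in> B s i}"
        by (simp only: card_atLeastLessThan)
      moreover have "1 \<le> j"
        using j by simp
      ultimately show "k + 1 - j \<le> card {i\<in>{j..n}. \<xi> i \<omega> \<in> B s i}"
        by arith
    qed
    then have "prob ?D \<le> prob ?C"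
      using C by (rule finite_measure_mono)
    \<comment> \<open>Outside \<open>?D\<close> the order statistic exceeds \<open>s\<close>, so its
      expectation is at least \<open>s\<close> times the probability of the complement.\<close>
    then have "c\<^sub>1 \<le> prob (space M - ?D)"
      unfolding prob_compl[OF D] using c p by linarith
    then have "ennreal (c\<^sub>1 * s) \<le> ennreal (s * prob (space M - ?D))"
      using s by (intro ennreal_leI) simp
    also have "\<dots> = ennreal s * emeasure M (space M - ?D)"
      using s by (simp add: emeasure_eq_measure ennreal_mult)
    also have "\<dots> = (\<integral>\<^sup>+ \<omega>. ennreal s * indicator (space M - ?D) \<omega> \<partial>M)"
      by (rule nn_integral_cmult_indicator[OF sets.compl_sets[OF D], symmetric])
    also have "\<dots> \<le> E"
      unfolding E_def
    proof (rule nn_integral_mono)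
      fix \<omega> assume \<omega>: "\<omega> \<in> space M"
      show "ennreal s * indicator (space M - ?D) \<omega> \<le> ennreal (k_min k n (\<lambda>i. \<bar>x i * \<xi> i \<omega>\<bar>))"
      proof (cases "\<omega> \<in> ?D")
        case False
        then have "\<not> k_min k n (\<lambda>i. \<bar>x i * \<xi> i \<omega>\<bar>) \<le> s"
          unfolding k_min_le using \<omega> by blast
        then have "ennreal s \<le> ennreal (k_min k n (\<lambda>i. \<bar>x i * \<xi> i \<omega>\<bar>))"
          by (intro ennreal_leI) linarith
        moreover have "\<omega> \<in> space M - ?D"
          using \<omega> False by blast
        ultimately show ?thesis
          by (simp only: indicator_simps mult_1_right)
      qed simp
    qed
    finally show "ennreal (c\<^sub>1 * s) \<le> E" .
  qed
  have lower: "ennreal c\<^sub>1 * m \<le> E"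
  proof -
    have "m \<in> (\<lambda>j. inverse (orlicz_norm (\<lambda>t. ennreal (N' j t)) {j..n} (\<lambda>i. 1 / x i))) ` {1..k}"
      unfolding m_def using k by (intro Max_in) auto
    then show ?thesis
      using lower_j by auto
  qed

  \<comment> \<open>The upper estimate\<close>
  have upper: "E \<le> ennreal (16 * (exp 1)\<^sup>2 * C\<^sub>N * ln (real k + 1)) * m"
    if conv: "convex_on {0..} N"
  proof -
    \<comment> \<open>\<open>t\<close> is the convex combination of 0 and \<open>a * t\<close> with
      weight \<open>1 / a\<close> on the latter, and \<open>N 0 = 0\<close>.\<close>
    have N_scale: "a * N t \<le> N (a * t)" if "a \<ge> 1" "t \<ge> 0" for a t
      using convex_onD[OF conv, of "1 / a" 0 "a * t"] that N_0 by (simp add: field_simps)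
    \<comment> \<open>Makes \<open>exp (- b)\<close> equal to
      \<open>1 / (real k + 1)\<^sup>2\<close>, which absorbs the factor \<open>k\<close> of the tail
      bound; \<open>k \<ge> 1\<close> gives the level \<open>2 * ln 2\<close> that this bound
      requires.\<close>
    define b where "b = 2 * ln (real k + 1)"
    have b: "b \<ge> 2 * ln 2"
      using k by (simp add: b_def)
    then have ln_k: "1 / 2 \<le> ln (real k + 1)"
      using ln_2 unfolding b_def by linarith
    have C\<^sub>N: "C\<^sub>N \<ge> 1"
    proof -
      have "exp (- N 1) < 1"
        using N_exp[of 1] F_anti[of 0 1] assms(15) by simp
      then have "N 1 > 0"
        by simp
      then show ?thesis
        by (auto simp: C\<^sub>N_def le_max_iff_disj)
    qed
    define K where "K = 16 * (exp 1)\<^sup>2 * C\<^sub>N * ln (real k + 1)"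
    \<comment> \<open>The correction to \<open>b\<close> is at most 1/2 by
      \<open>4 * k \<le> (k + 1)\<^sup>2\<close>, hence at most \<open>2 * ln (k + 1)\<close>, so
      the bracket is at most \<open>4 * ln (k + 1)\<close>. The remaining factor
      \<open>exp 1 * C\<^sub>N\<close> is at least 1.\<close>
    have K: "4 * exp 1 * (b + 2 * real k * exp (- b)) \<le> K"
    proof -
      have b_eq: "exp (- b) = 1 / (real k + 1)\<^sup>2"
        by (simp add: b_def exp_minus exp_double inverse_eq_divide)
      have "4 * real k \<le> (real k + 1)\<^sup>2"
        using zero_le_power2[of "real k - 1"] by (simp add: power2_eq_square algebra_simps)
      then have "2 * real k * exp (- b) \<le> 1 / 2"
        unfolding b_eq by (simp add: divide_le_eq)
      then have "b + 2 * real k * exp (- b) \<le> 4 * ln (real k + 1)"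
        using ln_k by (simp add: b_def)
      also have "\<dots> \<le> 4 * (exp 1 * C\<^sub>N) * ln (real k + 1)"
        using ln_k mult_mono[of 1 "exp 1 :: real" 1 "C\<^sub>N"] e C\<^sub>N by (intro mult_right_mono) auto
      finally have "4 * exp 1 * (b + 2 * real k * exp (- b)) \<le> 4 * exp 1 * (4 * (exp 1 * C\<^sub>N) * ln (real k + 1))"
        by (intro mult_left_mono) auto
      then show ?thesis
        by (simp add: K_def power2_eq_square mult_ac)
    qed
    have K0: "K > 0"
      unfolding K_def using C\<^sub>N k by (intro mult_pos_pos) auto
    \<comment> \<open>With \<open>s\<close> strictly above \<open>m\<close>, every norm constraint
      is violated at \<open>s\<close>; letting \<open>s\<close> tend to \<open>m\<close> comes
      last.\<close>
    have E_le: "E \<le> ennreal (K * s)" if s: "s > 0" "m < ennreal s" for s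
    proof -
      have sum: "real k - real j + 1 \<le> 2 * exp 1 * (\<Sum>i\<in>{j..n}. N (s / x i))" if j: "j \<in> {1..k}" for j
      proof -
        have "inverse (orlicz_norm (\<lambda>t. ennreal (N' j t)) {j..n} (\<lambda>i. 1 / x i)) \<le> m"
          unfolding m_def using j by (intro Max_ge) auto
        then have "1 < (\<Sum>i\<in>{j..n}. ennreal (N' j (\<bar>1 / x i\<bar> * s)))"
          using s by (intro inverse_orlicz_norm_less) auto
        then have "1 < 2 * exp 1 / (real k - real j + 1) * (\<Sum>i\<in>{j..n}. N (s / x i))"
          using N'_sum[OF j s(1)] by (simp add: ennreal_less_iff flip: ennreal_1)
        then show ?thesis
          using j by (simp add: field_simps)
      qed
      \<comment> \<open>Scaling \<open>s\<close> by \<open>4 * exp 1 * d\<close> multiplies each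
        \<open>N (s / x i)\<close> by at least that factor: \<open>2 * exp 1\<close> undoes the
        constant in \<open>sum\<close>, and \<open>2 * d\<close> is what the nested bound asks
        for.\<close>
      define c where "c = 4 * exp 1 * s"
      have tail: "prob {\<omega>\<in>space M. card {i\<in>{1..n}. \<xi> i \<omega> \<in> B (c * d) i} < k} \<le> real k * exp (- d)"
        if d: "d \<ge> 2 * ln 2" for d
      proof (rule prob_card_less_le_nested[OF assms(11) B_sets _ _ _ d k])
        have d0: "d \<ge> 1"
          using d ln_2 by simp
        have cd: "c * d \<ge> 0"
          using d0 s by (simp add: c_def)
        show "prob {\<omega>\<in>space M. \<xi> i \<omega> \<in> B (c * d) i} = 1 - exp (- N (c * d / x i))" if "i \<in> {1..n}" for i
          using prob_B[OF that cd] .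
        show "0 \<le> N (c * d / x i)" if "i \<in> {1..n}" for i
          using x[OF that] cd by (intro N_nonneg) simp
        show "antimono_on {1..n} (\<lambda>i. N (c * d / x i))"
        proof (rule monotone_onI)
          fix i i' assume i: "i \<in> {1..n}" "i' \<in> {1..n}" "i \<le> i'"
          then show "N (c * d / x i') \<le> N (c * d / x i)"
            using monotone_onD[OF assms(18) i] x[of i] x[of i'] cd
            by (intro N_mono divide_left_mono) auto
        qed
        fix j assume j: "j \<in> {1..k}"
        have "2 * d * (real k - real j + 1) \<le> 2 * d * (2 * exp 1 * (\<Sum>i\<in>{j..n}. N (s / x i)))"
          using sum[OF j] d0 by (intro mult_left_mono) auto
        also have "\<dots> = (\<Sum>i\<in>{j..n}. 4 * exp 1 * d * N (s / x i))"
          by (simp add: sum_distrib_left mult_ac)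
        also have "\<dots> \<le> (\<Sum>i\<in>{j..n}. N (c * d / x i))"
        proof (rule sum_mono)
          fix i assume "i \<in> {j..n}"
          then have "x i > 0"
            using j by (intro x) auto
          moreover have "1 \<le> 4 * exp 1 * d"
            using mult_mono[of 1 "4 * exp 1" 1 d] e d0 by simp
          ultimately show "4 * exp 1 * d * N (s / x i) \<le> N (c * d / x i)"
            using N_scale[of "4 * exp 1 * d" "s / x i"] s by (simp add: c_def mult_ac)
        qed
        finally show "2 * d * (real k - real j + 1) \<le> (\<Sum>i\<in>{j..n}. N (c * d / x i))" .
      qed
      have set_eq: "{\<omega>\<in>space M. k_min k n (\<lambda>i. \<bar>x i * \<xi> i \<omega>\<bar>) > t}
          = {\<omega>\<in>space M. card {i\<in>{1..n}. \<xi> i \<omega> \<in> B t i} < k}" for t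
        using k_min_le by (simp only: not_le[symmetric])
      have "E \<le> ennreal (c * (b + 2 * real k * exp (- b)))"
        unfolding E_def
      proof (rule nn_integral_le_of_exp_tail)
        show "c > 0"
          using s by (simp add: c_def)
        show "b \<ge> 0"
          using ln_k by (simp add: b_def)
        show "{\<omega>\<in>space M. k_min k n (\<lambda>i. \<bar>x i * \<xi> i \<omega>\<bar>) > c * (b + real r)} \<in> events" for r :: nat
          unfolding set_eq by (intro events_card[OF assms(11)] B_sets) simp
        show "prob {\<omega>\<in>space M. k_min k n (\<lambda>i. \<bar>x i * \<xi> i \<omega>\<bar>) > c * (b + real r)}
            \<le> real k * exp (- (b + real r))" for r :: nat
          unfolding set_eq using b by (intro tail) simp
      qed simp
      also have "c * (b + 2 * real k * exp (- b)) = 4 * exp 1 * (b + 2 * real k * exp (- b)) * s"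
        by (simp add: c_def mult_ac)
      also have "ennreal \<dots> \<le> ennreal (K * s)"
        using K s by (intro ennreal_leI mult_right_mono) auto
      finally show ?thesis .
    qed
    have "E \<le> ennreal K * m"
    proof (cases m)
      case top
      then show ?thesis
        using K0 by (simp add: ennreal_mult_top)
    next
      case (real r)
      show ?thesis
      proof (rule ennreal_le_epsilon)
        fix \<epsilon> :: real assume \<epsilon>: "\<epsilon> > 0"
        \<comment> \<open>The summand \<open>\<epsilon> / K\<close> becomes
          \<open>\<epsilon>\<close> after multiplication by \<open>K\<close>, and keeps the argument
          of \<open>E_le\<close> positive when \<open>r = 0\<close>.\<close>
        have "E \<le> ennreal (K * (r + \<epsilon> / K))"
          using real K0 \<epsilon> by (intro E_le) (auto simp: ennreal_less_iff add_nonneg_pos)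
        also have "\<dots> = ennreal K * m + ennreal \<epsilon>"
          using real K0 \<epsilon> by (simp add: distrib_left flip: ennreal_mult ennreal_plus)
        finally show "E \<le> ennreal K * m + ennreal \<epsilon>" .
      qed
    qed
    then show ?thesis
      by (simp add: K_def)
  qed
  show ?thesis
    using lower upper by blast
qed

end
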